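(* Let $P\subset\mathbb{R}^d$ be a set of $n$ points, $\gamma\in(0,1)$, $\epsilon,\delta\in(0,1)$, $s=\frac{\epsilon}{2+\epsilon}$, and $z=\frac{2}{(1-s)\epsilon}$ (assumed to be an integer). Run the following algorithm: let $t=(\delta+\gamma)n$; pick $p\in P$ uniformly at random and let $T=\{p\}$; for $i=1,\dots,z$: (1) letting $c_i$ be the center of $\mathbf{MEB}(T)$, compute a point $o_i$ with $\|o_i-c_i\|<s\frac{\epsilon}{1+\epsilon}\mathbf{Rad}(T)$; (2) let $Q$ be the set of the $t$ points of $P$ farthest from $o_i$ and let $l_i$ be the $(t+1)$-th largest distance from the points of $P$ to $o_i$; (3) pick $q\in Q$ uniformly at random and add it to $T$. Output $\mathbb{B}(o_{\hat i},l_{\hat i})$ where $\hat i=\arg\min_{1\le i\le z}l_i$. Then with probability at least $(1-\gamma)\big(\frac{\delta}{\gamma+\delta}\big)^z$, the output is a $(1+\epsilon,1-\delta)$-approximation for the MEB with outliers instance $(P,\gamma)$.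
   Context: For a finite set $A\subset\mathbb{R}^d$, $\mathbf{MEB}(A)$ is the closed ball of minimum radius containing $A$ and $\mathbf{Rad}(A)$ its radius; $\mathbb{B}(c,r)$ is the closed Euclidean ball. MEB with outliers: given $n$ points $P\subset\mathbb{R}^d$ and $\gamma\in[0,1)$, find the smallest ball covering $(1-\gamma)n$ points of $P$; $P_{\mathrm{opt}}$ denotes a subset $Q\subset P$ with $|Q|=(1-\gamma)n$ minimizing $\mathbf{Rad}(Q)$. A $(1+\epsilon,1-\delta)$-approximation (bi-criteria) is a ball covering at least $(1-\delta-\gamma)n$ points of $P$ with radius at most $(1+\epsilon)\mathbf{Rad}(P_{\mathrm{opt}})$. Quantities such as $t$ are assumed to be integers.
   Formalization: The strict bound on ‖o_i−c_i‖ cannot hold when Rad(T)=0 (always in round 1, T={p}); there o_i=c_i is required instead. If t≥n, Q is taken to be P and the nonexistent (t+1)-th largest distance is set to 0. *)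

theory Defs
  imports "HOL-Analysis.Analysis" "HOL-Probability.Probability"
begin

definition is_meb :: "'a::euclidean_space set \<Rightarrow> 'a \<Rightarrow> real \<Rightarrow> bool" where
  "is_meb A c r \<longleftrightarrow> 0 \<le> r \<and> A \<subseteq> cball c r \<and>
     (\<forall>c' r'. 0 \<le> r' \<and> A \<subseteq> cball c' r' \<longrightarrow> r \<le> r')"

text \<open>Center and radius of the minimum enclosing ball; both descriptions are proper for
  finite nonempty sets.\<close>

definition meb_center :: "'a::euclidean_space set \<Rightarrow> 'a" where
  "meb_center A = (THE c. \<exists>r. is_meb A c r)"

definition meb_rad :: "'a::euclidean_space set \<Rightarrow> real" where
  "meb_rad A = (THE r. \<exists>c. is_meb A c r)"

definition is_P_opt :: "'a::euclidean_space set \<Rightarrow> real \<Rightarrow> 'a set \<Rightarrow> bool" where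
  "is_P_opt P \<gamma> Q \<longleftrightarrow> Q \<subseteq> P \<and> real (card Q) = (1 - \<gamma>) * real (card P) \<and>
     (\<forall>Q'. Q' \<subseteq> P \<and> real (card Q') = (1 - \<gamma>) * real (card P) \<longrightarrow> meb_rad Q \<le> meb_rad Q')"

text \<open>The ball \<open>cball c r\<close> is a \<open>(1 + \<epsilon>, 1 - \<delta>)\<close>-approximation for the instance \<open>(P, \<gamma>)\<close>.
  All optimal subsets have the same radius, so the existential is independent of the witness.\<close>

definition bicriteria_approx ::
    "'a::euclidean_space set \<Rightarrow> real \<Rightarrow> real \<Rightarrow> real \<Rightarrow> 'a \<Rightarrow> real \<Rightarrow> bool" where
  "bicriteria_approx P \<gamma> \<epsilon> \<delta> c r \<longleftrightarrow> 0 \<le> r \<and>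
     (1 - \<delta> - \<gamma>) * real (card P) \<le> real (card (P \<inter> cball c r)) \<and>
     (\<exists>Q. is_P_opt P \<gamma> Q \<and> r \<le> (1 + \<epsilon>) * meb_rad Q)"

text \<open>If \<open>T\<close> has radius \<open>0\<close> (in particular in the first round, where \<open>T\<close> is a singleton),
  the strict bound on the distance to the center is unsatisfiable; the point is then required
  to be the exact center.\<close>

definition approx_center :: "real \<Rightarrow> real \<Rightarrow> 'a::euclidean_space set \<Rightarrow> 'a \<Rightarrow> bool" where
  "approx_center s \<epsilon> T x \<longleftrightarrow>
     (if meb_rad T = 0 then x = meb_center T
      else norm (x - meb_center T) < s * (\<epsilon> / (1 + \<epsilon>)) * meb_rad T)"

text \<open>\<open>Q\<close> consists of \<open>t\<close> points of \<open>P\<close> farthest from \<open>x\<close>, ties being broken arbitrarily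
  (of all points if \<open>t\<close> exceeds the cardinality of \<open>P\<close>).\<close>

definition is_farthest_set :: "'a::euclidean_space set \<Rightarrow> 'a \<Rightarrow> nat \<Rightarrow> 'a set \<Rightarrow> bool" where
  "is_farthest_set P x t Q \<longleftrightarrow> Q \<subseteq> P \<and> card Q = min t (card P) \<and>
     (\<forall>q\<in>Q. \<forall>p\<in>P - Q. dist p x \<le> dist q x)"

text \<open>The \<open>k\<close>-th largest distance (counting from 1, with multiplicity) from the points of \<open>P\<close>
  to \<open>x\<close>; by convention \<open>0\<close> if \<open>P\<close> has fewer than \<open>k\<close> points.\<close>

definition kth_largest_dist :: "nat \<Rightarrow> 'a::euclidean_space set \<Rightarrow> 'a \<Rightarrow> real" where
  "kth_largest_dist k P x =
     (if 1 \<le> k \<and> k \<le> card P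
      then rev (sorted_list_of_multiset (image_mset (\<lambda>p. dist p x) (mset_set P))) ! (k - 1)
      else 0)"

text \<open>The list of points drawn so far is the complete history of a run: the set \<open>T\<close> at the
  start of round \<open>i\<close> is the set of its first \<open>i\<close> entries. The point \<open>o\<^sub>i\<close> and the set \<open>Q\<close>
  computed in round \<open>i\<close> are \<open>ctr h\<close> and \<open>far h\<close>, where \<open>h\<close> is the history of length \<open>i\<close>.\<close>

fun draws :: "'a set \<Rightarrow> ('a list \<Rightarrow> 'a set) \<Rightarrow> nat \<Rightarrow> 'a list pmf" where
  "draws P far 0 = map_pmf (\<lambda>p. [p]) (pmf_of_set P)"
| "draws P far (Suc i) =
     bind_pmf (draws P far i) (\<lambda>h.
     bind_pmf (pmf_of_set (far h)) (\<lambda>q.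
     return_pmf (h @ [q])))"

text \<open>The distribution of the output, a ball given by its center and radius.\<close>

definition meb_outliers_alg ::
    "'a::euclidean_space set \<Rightarrow> nat \<Rightarrow> nat \<Rightarrow> ('a list \<Rightarrow> 'a) \<Rightarrow> ('a list \<Rightarrow> 'a set) \<Rightarrow> ('a \<times> real) pmf"
  where
  "meb_outliers_alg P t z ctr far =
     map_pmf (\<lambda>h.
       let c = (\<lambda>i. ctr (take i h));
           l = (\<lambda>i. kth_largest_dist (t + 1) P (c i));
           i = arg_min_on l {1..z}
       in (c i, l i)) (draws P far z)"

end

theory Submission
  imports Defs
begin

text \<open>Fix an optimal subset \<open>O\<close>, of radius \<open>r\<close>. Each set of \<open>t\<close> farthest points contains at
  least \<open>t - \<gamma> n = \<delta> n\<close> points of \<open>O\<close>, so with the stated probability all draws lie in \<open>O\<close>.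
  In that case some \<open>l\<^sub>i\<close> is at most \<open>(1 + \<epsilon>) r\<close>. Otherwise every drawn point has distance
  more than \<open>D = (1 + (1 - s) \<epsilon>) r\<close> from the exact center of the current set, since
  \<open>\<parallel>o\<^sub>i - c\<^sub>i\<parallel> \<le> s \<epsilon> r\<close>. If the center moves by \<open>L\<close> in a round, the radius \<open>R\<close> becomes some
  \<open>R'\<close> with \<open>R' > D - L\<close> and \<open>R'\<^sup>2 \<ge> R\<^sup>2 + L\<^sup>2\<close>, whence the radius after \<open>i\<close> rounds
  exceeds \<open>i D / (i + 2)\<close>. For \<open>i = z = 2 / ((1 - s) \<epsilon>)\<close> this bound is \<open>r\<close>, although the
  set is contained in \<open>O\<close>.\<close>

subsection \<open>Minimum enclosing balls\<close>

text \<open>Compactness: if \<open>A\<close> lies within \<open>R\<close> of a point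
  \<open>a\<close> of \<open>A\<close>, only enclosing balls of radius at most \<open>R\<close>
  compete, and their centers lie in \<open>cball a R\<close>. These pairs of center and radius form
  a compact set, on which the radius attains its minimum.\<close>

lemma is_meb_exists:
  fixes A :: "'a::euclidean_space set"
  assumes "bounded A" "A \<noteq> {}"
  shows "\<exists>c r. is_meb A c r"
proof -
  obtain a where a: "a \<in> A" using assms by auto
  obtain R where "\<forall>x\<in>A. dist a x \<le> R" using assms(1) bounded_any_center[of A a] by auto
  then have R: "A \<subseteq> cball a R" "0 \<le> R" using a by force+
  define K where "K = cball a R \<times> {0..R} \<inter> (\<Inter>x\<in>A. {y. dist (fst y) x \<le> snd y})"
  have "compact K"
    unfolding K_def
    by (intro compact_Int_closed compact_Times compact_cball compact_Icc closed_INT ballI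
        closed_Collect_le continuous_intros)
  moreover have "(a, R) \<in> K" using R by (auto simp: K_def)
  ultimately obtain y where y: "y \<in> K" "\<And>w. w \<in> K \<Longrightarrow> snd y \<le> snd w"
    using continuous_attains_inf[of K snd] continuous_on_snd[OF continuous_on_id, of K] by blast
  have "snd y \<le> r'" if "0 \<le> r'" "A \<subseteq> cball c' r'" for c' r'
  proof (cases "r' \<le> R")
    case True
    have "dist c' a \<le> R" using a that True by (auto simp: subset_iff)
    then have "(c', r') \<in> K" using that True by (auto simp: K_def dist_commute subset_iff)
    then show ?thesis using y(2) by fastforce
  next
    case False
    then show ?thesis using y(1) by (auto simp: K_def)
  qed
  then have "is_meb A (fst y) (snd y)"
    using y(1) by (auto simp: is_meb_def K_def)
  then show ?thesis by blast
qed

text \<open>Stewart's theorem for the point at fraction \<open>u\<close> of the way from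
  \<open>c\<close> to \<open>d\<close>.\<close>

lemma dist_square_convex_combination:
  fixes p c d :: "'a::real_inner"
  shows "(dist ((1 - u) *\<^sub>R c + u *\<^sub>R d) p)\<^sup>2
    = (1 - u) * (dist c p)\<^sup>2 + u * (dist d p)\<^sup>2 - u * (1 - u) * (dist c d)\<^sup>2"
proof -
  have "(1 - u) *\<^sub>R c + u *\<^sub>R d - p = (1 - u) *\<^sub>R (c - p) + u *\<^sub>R (d - p)"
    by (simp add: algebra_simps)
  moreover have "c - d = (c - p) - (d - p)" by simp
  ultimately show ?thesis
    unfolding dist_norm power2_norm_eq_inner
    by (simp only: inner_simps inner_commute[of "d - p" "c - p"]) (simp add: algebra_simps)
qed

text \<open>The ball centered at \<open>(1 - u) c + u c'\<close> is no smaller than the minimal one; let \<open>u\<close> tend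
  to \<open>0\<close>.\<close>

lemma is_meb_radius_growth:
  assumes "is_meb A c r" "A \<subseteq> cball c' r'" "0 \<le> r'" "A \<noteq> {}"
  shows "r\<^sup>2 + (dist c c')\<^sup>2 \<le> r'\<^sup>2"
proof -
  have r: "0 \<le> r" "A \<subseteq> cball c r"
    and min: "\<And>c' r'. 0 \<le> r' \<Longrightarrow> A \<subseteq> cball c' r' \<Longrightarrow> r \<le> r'"
    using assms(1) by (auto simp: is_meb_def)
  let ?L = "(dist c c')\<^sup>2"
  have *: "(1 - u) * ?L \<le> r'\<^sup>2 - r\<^sup>2" if u: "0 < u" "u < 1" for u :: real
  proof -
    let ?x = "(1 - u) *\<^sub>R c + u *\<^sub>R c'"
    \<comment> \<open>Stewart's identity with the two distances replaced by their bounds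
      \<open>r\<close> and \<open>r'\<close>.\<close>
    define b where "b = (1 - u) * r\<^sup>2 + u * r'\<^sup>2 - u * (1 - u) * ?L"
    have b: "(dist ?x p)\<^sup>2 \<le> b" if "p \<in> A" for p
    proof -
      have "(dist c p)\<^sup>2 \<le> r\<^sup>2" "(dist c' p)\<^sup>2 \<le> r'\<^sup>2"
        using that r assms by (auto intro!: power_mono)
      then have "(1 - u) * (dist c p)\<^sup>2 \<le> (1 - u) * r\<^sup>2" "u * (dist c' p)\<^sup>2 \<le> u * r'\<^sup>2"
        using u by (auto intro: mult_left_mono)
      then show ?thesis unfolding dist_square_convex_combination b_def by linarith
    qed
    have "0 \<le> b" using b assms(4) by (metis all_not_in_conv order_trans zero_le_power2)
    moreover have "A \<subseteq> cball ?x (sqrt b)"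
      using b by (auto simp: real_le_rsqrt)
    ultimately have "r\<^sup>2 \<le> b"
      using min[of "sqrt b" ?x] r(1) by (simp add: real_le_rsqrt sqrt_ge_absD)
    \<comment> \<open>The terms of order zero in \<open>u\<close> cancel, so a factor
      \<open>u\<close> can be divided out before the limit.\<close>
    then have "0 \<le> u * (r'\<^sup>2 - r\<^sup>2 - (1 - u) * ?L)" by (simp add: b_def algebra_simps)
    then show ?thesis using u by (simp add: zero_le_mult_iff)
  qed
  have "((\<lambda>u. (1 - u) * ?L) \<longlongrightarrow> (1 - 0) * ?L) (at_right (0::real))"
    by (intro tendsto_intros)
  moreover have "eventually (\<lambda>u. (1 - u) * ?L \<le> r'\<^sup>2 - r\<^sup>2) (at_right (0::real))"
    using * by (auto intro: eventually_at_rightI[of 0 1])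
  ultimately have "(1 - 0) * ?L \<le> r'\<^sup>2 - r\<^sup>2"
    by (intro tendsto_upperbound) auto
  then show ?thesis by simp
qed

text \<open>Mutual minimality makes the radii equal; the growth inequality then leaves no room for a
  distance between the centers.\<close>

lemma is_meb_unique:
  assumes "is_meb A c r" "is_meb A c' r'" "A \<noteq> {}"
  shows "c = c'" "r = r'"
proof -
  show "r = r'" using assms by (auto simp: is_meb_def intro: antisym)
  then show "c = c'"
    using is_meb_radius_growth[OF assms(1), of c' r'] assms(2,3) by (auto simp: is_meb_def)
qed

lemma is_meb_meb:
  assumes "finite A" "A \<noteq> {}"
  shows "is_meb A (meb_center A) (meb_rad A)"
proof -
  obtain c r where cr: "is_meb A c r"
    using is_meb_exists[OF finite_imp_bounded] assms by blast
  have "meb_center A = c" "meb_rad A = r"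
    unfolding meb_center_def meb_rad_def
    using cr is_meb_unique[OF _ cr assms(2)] by (blast intro: the_equality)+
  then show ?thesis using cr by simp
qed

lemma meb_rad_nonneg: "finite A \<Longrightarrow> A \<noteq> {} \<Longrightarrow> 0 \<le> meb_rad A"
  using is_meb_meb by (auto simp: is_meb_def)

lemma meb_rad_mono:
  assumes "A \<subseteq> B" "finite B" "A \<noteq> {}"
  shows "meb_rad A \<le> meb_rad B"
proof -
  have "is_meb A (meb_center A) (meb_rad A)" "is_meb B (meb_center B) (meb_rad B)"
    using assms by (auto intro!: is_meb_meb finite_subset[of A B])
  then show ?thesis using assms(1) unfolding is_meb_def by (meson subset_trans)
qed

lemma meb_rad_singleton: "meb_rad {p} = 0"
proof -
  have "is_meb {p} (meb_center {p}) (meb_rad {p})" by (simp add: is_meb_meb)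
  moreover have "{p} \<subseteq> cball p 0" by simp
  ultimately show ?thesis unfolding is_meb_def by (meson antisym order_refl)
qed

text \<open>The minimal ball of \<open>B\<close> is one of the balls enclosing \<open>A\<close>, so
  every displacement of the center is paid for in radius.\<close>

lemma meb_rad_growth:
  assumes "A \<subseteq> B" "finite B" "A \<noteq> {}"
  shows "(meb_rad A)\<^sup>2 + (dist (meb_center A) (meb_center B))\<^sup>2 \<le> (meb_rad B)\<^sup>2"
proof (rule is_meb_radius_growth[OF _ _ _ assms(3)])
  show "is_meb A (meb_center A) (meb_rad A)"
    using assms by (auto intro!: is_meb_meb finite_subset[of A B])
  have "is_meb B (meb_center B) (meb_rad B)"
    using assms by (auto intro!: is_meb_meb)
  then show "A \<subseteq> cball (meb_center B) (meb_rad B)" "0 \<le> meb_rad B"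
    using assms(1) by (auto simp: is_meb_def)
qed

lemma dist_meb_center_le:
  assumes "finite A" "p \<in> A"
  shows "dist (meb_center A) p \<le> meb_rad A"
proof -
  have "is_meb A (meb_center A) (meb_rad A)" using assms by (intro is_meb_meb) auto
  then show ?thesis using assms(2) by (auto simp: is_meb_def)
qed

section \<open>Growth of the radius under far insertions\<close>

text \<open>The two lower bounds on \<open>R'\<close> pull in opposite directions in
  \<open>L\<close>. If \<open>R'\<close> were at most \<open>(i + 1) * D / (i + 3)\<close>, the
  first would force \<open>L > 2 * D / (i + 3)\<close>, which contradicts the second.\<close>

lemma radius_step_bound:
  fixes R R' L D i :: real
  assumes "0 \<le> i" "0 \<le> D" "0 \<le> R'" "D - L < R'" "R\<^sup>2 + L\<^sup>2 \<le> R'\<^sup>2" "i * D \<le> (i + 2) * R"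
  shows "(i + 1) * D < (i + 3) * R'"
proof (rule ccontr)
  assume "\<not> ?thesis"
  then have R': "R' \<le> (i + 1) * D / (i + 3)" using assms(1) by (simp add: field_simps)
  have "2 * D / (i + 3) = D - (i + 1) * D / (i + 3)" using assms(1) by (simp add: field_simps)
  then have "2 * D / (i + 3) < L" using R' assms by linarith
  then have "(2 * D / (i + 3))\<^sup>2 < L\<^sup>2" using assms by (intro power_strict_mono) auto
  moreover have "i * D / (i + 2) \<le> R" using assms by (simp add: field_simps)
  then have "(i * D / (i + 2))\<^sup>2 \<le> R\<^sup>2" using assms by (intro power_mono) auto
  moreover have "R'\<^sup>2 \<le> ((i + 1) * D / (i + 3))\<^sup>2" using R' assms by (intro power_mono) auto
  ultimately have "(2 * D / (i + 3))\<^sup>2 + (i * D / (i + 2))\<^sup>2 < ((i + 1) * D / (i + 3))\<^sup>2"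
    using assms by linarith
  \<comment> \<open>From \<open>(i + 1)^2 - 2^2 = (i - 1) * (i + 3)\<close>.\<close>
  moreover have "((i + 1) * D / (i + 3))\<^sup>2 = (2 * D / (i + 3))\<^sup>2 + (i - 1) / (i + 3) * D\<^sup>2"
    using assms(1) by (simp add: divide_simps power2_eq_square) (simp add: algebra_simps)
  \<comment> \<open>Clearing denominators leaves \<open>i^3 + 3 * i^2 - 4\<close> on the left and
    \<open>i^3 + 3 * i^2\<close> on the right.\<close>
  moreover have "(i - 1) / (i + 3) \<le> (i / (i + 2))\<^sup>2"
    using assms(1) by (simp add: divide_simps power2_eq_square) (simp add: algebra_simps)
  then have "(i - 1) / (i + 3) * D\<^sup>2 \<le> (i / (i + 2))\<^sup>2 * D\<^sup>2" by (rule mult_right_mono) simp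
  ultimately show False by (simp add: power_divide power_mult_distrib)
qed

text \<open>Strictness of the conclusion for \<open>k \<ge> 1\<close> also covers the degenerate case \<open>D = 0\<close>.\<close>

lemma meb_rad_far_insertions:
  fixes h :: "'a::euclidean_space list"
  assumes "0 \<le> D" "k < length h"
    and far: "\<And>i. 1 \<le> i \<Longrightarrow> i \<le> k \<Longrightarrow> D < dist (meb_center (set (take i h))) (h ! i)"
  shows "real k * D \<le> (real k + 2) * meb_rad (set (take (Suc k) h))
    \<and> (1 \<le> k \<longrightarrow> real k * D < (real k + 2) * meb_rad (set (take (Suc k) h)))"
  using assms(2,3)
proof (induction k)
  case 0
  then have "take (Suc 0) h = [h ! 0]" by (cases h) auto
  then show ?case by (simp add: meb_rad_singleton)
next
  case (Suc k)
  let ?A = "set (take (Suc k) h)" and ?B = "set (take (Suc (Suc k)) h)"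
  have IH: "real k * D \<le> (real k + 2) * meb_rad ?A" using Suc by simp
  have B: "?B = insert (h ! Suc k) ?A"
    using Suc.prems(1) by (simp add: take_Suc_conv_app_nth[of "Suc k" h])
  have ne: "?A \<noteq> {}" using Suc.prems(1) by auto
  \<comment> \<open>The new point lies in the new ball, so its distance from the old center is at
    most the shift of the center plus the new radius.\<close>
  have "D < dist (meb_center ?A) (h ! Suc k)" using Suc.prems(2)[of "Suc k"] by simp
  also have "\<dots> \<le> dist (meb_center ?A) (meb_center ?B) + dist (meb_center ?B) (h ! Suc k)"
    by (rule dist_triangle)
  also have "dist (meb_center ?B) (h ! Suc k) \<le> meb_rad ?B"
    by (rule dist_meb_center_le) (simp_all add: B)
  finally have "D - dist (meb_center ?A) (meb_center ?B) < meb_rad ?B" by simp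
  moreover have "(meb_rad ?A)\<^sup>2 + (dist (meb_center ?A) (meb_center ?B))\<^sup>2 \<le> (meb_rad ?B)\<^sup>2"
    using ne by (intro meb_rad_growth) (auto simp: B)
  moreover have "0 \<le> meb_rad ?B" by (intro meb_rad_nonneg) (auto simp: B)
  ultimately have "(real k + 1) * D < (real k + 3) * meb_rad ?B"
    using radius_step_bound[of "real k" D "meb_rad ?B"] IH assms(1) by simp
  then show ?case by (simp add: algebra_simps)
qed

subsection \<open>Farthest points\<close>

text \<open>In the decreasing list \<open>xs\<close> of distances with \<open>l = xs ! t\<close>,
  the entries from index \<open>t\<close> on are at most \<open>l\<close>, and the
  \<open>t + 1\<close> entries up to index \<open>t\<close> are at least \<open>l\<close>. Counting
  entries with multiplicity amounts to counting points.\<close>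

lemma
  fixes x :: "'a::euclidean_space"
  assumes "finite P" "t < card P"
  shows kth_largest_dist_nonneg: "0 \<le> kth_largest_dist (t + 1) P x"
    and card_le_kth_largest_dist:
      "card P - t \<le> card (P \<inter> cball x (kth_largest_dist (t + 1) P x))"
    and card_ge_kth_largest_dist:
      "t + 1 \<le> card {p \<in> P. kth_largest_dist (t + 1) P x \<le> dist p x}"
proof -
  define M where "M = image_mset (\<lambda>p. dist p x) (mset_set P)"
  define xs where "xs = rev (sorted_list_of_multiset M)"
  define l where "l = kth_largest_dist (t + 1) P x"
  have mset: "mset xs = M" by (simp add: xs_def)
  have len: "length xs = card P"
    using arg_cong[OF mset, of size] by (simp add: M_def)
  have l: "l = xs ! t" using assms by (simp add: l_def kth_largest_dist_def xs_def M_def)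
  have anti: "xs ! j \<le> xs ! i" if "i \<le> j" "j < card P" for i j
  proof -
    have "sorted (rev xs)" by (simp add: xs_def)
    then show ?thesis using that len by (auto simp: sorted_rev_iff_nth_mono)
  qed
  have card_filter: "card {p \<in> P. Q (dist p x)} = length (filter Q xs)" for Q
  proof -
    have "length (filter Q xs) = size (filter_mset Q M)"
      by (metis mset mset_filter size_mset)
    also have "\<dots> = card {p \<in> P. Q (dist p x)}"
      using assms(1) by (simp add: M_def filter_mset_image_mset filter_mset_mset_set)
    finally show ?thesis by simp
  qed
  have "l \<in># M" using l len assms(2) mset by (metis nth_mem set_mset_mset)
  then show "0 \<le> kth_largest_dist (t + 1) P x"
    using assms(1) by (auto simp: M_def l_def)
  have "{t..<card P} \<subseteq> {i. i < length xs \<and> xs ! i \<le> l}" using anti len l by auto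
  from card_mono[OF _ this] have "card P - t \<le> length (filter (\<lambda>d. d \<le> l) xs)"
    by (simp add: length_filter_conv_card)
  also have "\<dots> = card {p \<in> P. dist p x \<le> l}" by (rule card_filter[symmetric])
  also have "{p \<in> P. dist p x \<le> l} = P \<inter> cball x l" by (auto simp: dist_commute)
  finally show "card P - t \<le> card (P \<inter> cball x (kth_largest_dist (t + 1) P x))"
    by (simp add: l_def)
  have "{..t} \<subseteq> {i. i < length xs \<and> l \<le> xs ! i}" using anti len l assms(2) by auto
  from card_mono[OF _ this] have "t + 1 \<le> length (filter (\<lambda>d. l \<le> d) xs)"
    by (simp add: length_filter_conv_card)
  then show "t + 1 \<le> card {p \<in> P. kth_largest_dist (t + 1) P x \<le> dist p x}"
    using card_filter[of "\<lambda>d. l \<le> d"] by (simp add: l_def)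
qed

text \<open>Pigeonhole: at least \<open>t + 1\<close> points reach the \<open>(t + 1)\<close>-th
  largest distance, so one of them lies outside \<open>Q\<close>, and no element of \<open>Q\<close>
  is nearer than that one.\<close>

lemma is_farthest_set_dist_ge:
  assumes "finite P" "t < card P" "is_farthest_set P x t Q" "q \<in> Q"
  shows "kth_largest_dist (t + 1) P x \<le> dist q x"
proof -
  let ?S = "{p \<in> P. kth_largest_dist (t + 1) P x \<le> dist p x}"
  have Q: "Q \<subseteq> P" "card Q = t" "\<forall>q\<in>Q. \<forall>p\<in>P - Q. dist p x \<le> dist q x"
    using assms by (auto simp: is_farthest_set_def)
  have "\<not> ?S \<subseteq> Q"
    using card_mono[of Q ?S] card_ge_kth_largest_dist[OF assms(1,2), of x] Q
      finite_subset[OF Q(1) assms(1)] by auto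
  then obtain p where "p \<in> P - Q" "kth_largest_dist (t + 1) P x \<le> dist p x" by auto
  then show ?thesis using Q(3) assms(4) order_trans by blast
qed

subsection \<open>The random draws\<close>

text \<open>Integrality of the prescribed size makes the finite family of candidates nonempty, so
  the minimal radius is attained.\<close>

lemma is_P_opt_exists:
  assumes "finite P" "(1 - \<gamma>) * real (card P) \<in> \<nat>" "0 \<le> \<gamma>"
  shows "\<exists>Q. is_P_opt P \<gamma> Q"
proof -
  define F where "F = {Q. Q \<subseteq> P \<and> real (card Q) = (1 - \<gamma>) * real (card P)}"
  obtain m where m: "(1 - \<gamma>) * real (card P) = real m" using assms(2) by (auto elim: Nats_cases)
  have "(1 - \<gamma>) * real (card P) \<le> 1 * real (card P)"
    using assms(3) by (intro mult_right_mono) auto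
  then have "m \<le> card P" using m by simp
  then obtain Q where "Q \<subseteq> P" "card Q = m" by (meson obtain_subset_with_card_n)
  then have "F \<noteq> {}" using m by (auto simp: F_def)
  moreover have "finite F" using assms(1) by (auto simp: F_def)
  ultimately obtain Q where "Q \<in> F" "\<And>Q'. Q' \<in> F \<Longrightarrow> meb_rad Q \<le> meb_rad Q'"
    using arg_min_if_finite(1)[of F meb_rad] arg_min_least[of F _ meb_rad] by blast
  then show ?thesis by (auto simp: is_P_opt_def F_def)
qed

text \<open>Each first-stage outcome in \<open>A\<close> passes at least the fraction
  \<open>c\<close> of its mass on to \<open>B\<close>; integrating \<open>c\<close> times the
  indicator of \<open>A\<close> gives the bound.\<close>

lemma prob_bind_pmf_ge:
  assumes "p \<le> measure_pmf.prob M A" "0 \<le> c"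
    and "\<And>x. x \<in> set_pmf M \<Longrightarrow> x \<in> A \<Longrightarrow> c \<le> measure_pmf.prob (N x) B"
  shows "p * c \<le> measure_pmf.prob (bind_pmf M N) B"
proof -
  have "ennreal (measure_pmf.prob M A * c) = (\<integral>\<^sup>+x. ennreal c * indicator A x \<partial>measure_pmf M)"
    using assms(2) by (simp add: nn_integral_cmult_indicator measure_pmf.emeasure_eq_measure
        ennreal_mult mult.commute)
  also have "\<dots> \<le> (\<integral>\<^sup>+x. emeasure (measure_pmf (N x)) B \<partial>measure_pmf M)"
    using assms(3)
    by (intro nn_integral_mono_AE)
      (auto simp: AE_measure_pmf_iff measure_pmf.emeasure_eq_measure ennreal_leI split: split_indicator)
  also have "\<dots> = ennreal (measure_pmf.prob (bind_pmf M N) B)"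
    by (simp add: emeasure_bind_pmf flip: measure_pmf.emeasure_eq_measure)
  finally have "measure_pmf.prob M A * c \<le> measure_pmf.prob (bind_pmf M N) B"
    by (simp add: assms(2))
  then show ?thesis using mult_right_mono[OF assms(1,2)] by linarith
qed

text \<open>Turns the random process into facts about each possible history. The initial point sits
  at index 0, hence the length \<open>Suc i\<close>; \<open>far\<close> is only queried on histories
  of length at most \<open>z\<close>.\<close>

lemma set_pmf_draws:
  assumes "finite P" "P \<noteq> {}"
    and far: "\<And>h. h \<noteq> [] \<Longrightarrow> set h \<subseteq> P \<Longrightarrow> length h \<le> z \<Longrightarrow> far h \<subseteq> P \<and> far h \<noteq> {}"
    and "i \<le> z" "h \<in> set_pmf (draws P far i)"
  shows "length h = Suc i \<and> set h \<subseteq> P \<and> (\<forall>j. 1 \<le> j \<and> j \<le> i \<longrightarrow> h ! j \<in> far (take j h))"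
  using assms(4,5)
proof (induction i arbitrary: h)
  case 0
  then show ?case using assms(1,2) by auto
next
  case (Suc i)
  then obtain g q where g: "g \<in> set_pmf (draws P far i)" "q \<in> set_pmf (pmf_of_set (far g))"
    and h: "h = g @ [q]" by auto
  have IH: "length g = Suc i" "set g \<subseteq> P" "\<And>j. 1 \<le> j \<Longrightarrow> j \<le> i \<Longrightarrow> g ! j \<in> far (take j g)"
    using Suc.IH[OF _ g(1)] Suc.prems by auto
  moreover have "g \<noteq> []" using IH(1) by auto
  ultimately have "far g \<subseteq> P" "far g \<noteq> {}" using far[of g] Suc.prems by auto
  then have q: "q \<in> far g" "q \<in> P"
    using g(2) finite_subset[OF _ assms(1)] by auto
  have "h ! j \<in> far (take j h)" if "1 \<le> j" "j \<le> Suc i" for j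
    using that IH q by (cases "j = Suc i") (auto simp: h nth_append)
  then show ?case using IH q by (auto simp: h)
qed

text \<open>The first point contributes the factor \<open>a\<close>; each later round keeps the
  history inside \<open>A\<close> with conditional probability at least \<open>b\<close>, whatever
  has been drawn so far.\<close>

lemma prob_draws_subset:
  assumes "finite P" "P \<noteq> {}" "A \<subseteq> P" "a * real (card P) \<le> real (card A)" "0 \<le> b"
    and far: "\<And>h. h \<noteq> [] \<Longrightarrow> set h \<subseteq> P \<Longrightarrow> length h \<le> z \<Longrightarrow>
      far h \<subseteq> P \<and> far h \<noteq> {} \<and> b * real (card (far h)) \<le> real (card (far h \<inter> A))"
    and "i \<le> z"
  shows "a * b ^ i \<le> measure_pmf.prob (draws P far i) {h. set h \<subseteq> A}"
  using assms(7)
proof (induction i)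
  case 0
  have "(\<lambda>p. [p]) -` {h. set h \<subseteq> A} = A" by auto
  moreover have "0 < card P" using assms(1,2) by (simp add: card_gt_0_iff)
  moreover have "P \<inter> A = A" using assms(3) by auto
  ultimately show ?case using assms(1-4) by (simp add: measure_pmf_of_set field_simps)
next
  case (Suc i)
  have "(a * b ^ i) * b \<le> measure_pmf.prob (draws P far (Suc i)) {h. set h \<subseteq> A}"
    unfolding draws.simps
  proof (rule prob_bind_pmf_ge)
    show "a * b ^ i \<le> measure_pmf.prob (draws P far i) {h. set h \<subseteq> A}" using Suc by simp
    fix h assume h: "h \<in> set_pmf (draws P far i)" "h \<in> {h. set h \<subseteq> A}"
    have "length h = Suc i" "set h \<subseteq> P"
      using set_pmf_draws[of P z far i h] assms(1,2) far Suc.prems h(1) by auto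
    moreover from this have "h \<noteq> []" by auto
    ultimately have f: "far h \<subseteq> P" "far h \<noteq> {}" "b * real (card (far h)) \<le> real (card (far h \<inter> A))"
      using far[of h] Suc.prems by auto
    have fin: "finite (far h)" using f(1) assms(1) by (rule finite_subset)
    \<comment> \<open>For a history inside \<open>A\<close> the event depends on the new point
      alone.\<close>
    have "(\<lambda>q. h @ [q]) -` {h. set h \<subseteq> A} = A" using h(2) by auto
    then have "measure_pmf.prob (map_pmf (\<lambda>q. h @ [q]) (pmf_of_set (far h))) {h. set h \<subseteq> A}
        = real (card (far h \<inter> A)) / real (card (far h))"
      using f(2) fin by (simp add: measure_pmf_of_set)
    moreover have "b \<le> real (card (far h \<inter> A)) / real (card (far h))"
      using f(2,3) fin by (simp add: pos_le_divide_eq card_gt_0_iff)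
    ultimately show "b \<le> measure_pmf.prob (pmf_of_set (far h) \<bind> (\<lambda>q. return_pmf (h @ [q])))
        {h. set h \<subseteq> A}"
      by (simp add: map_pmf_def)
  qed (use assms(5) in simp)
  then show ?case by (simp add: mult_ac)
qed

text \<open>The output has the smallest of the \<open>z\<close> radii, so a single good round
  suffices. This passes from events on histories to events on outputs.\<close>

lemma prob_meb_outliers_alg_ge:
  assumes "\<And>h. h \<in> set_pmf (draws P far z) \<Longrightarrow> h \<in> H \<Longrightarrow>
      \<exists>j\<in>{1..z}. kth_largest_dist (t + 1) P (ctr (take j h)) \<le> r"
    and "\<And>c l. l = kth_largest_dist (t + 1) P c \<Longrightarrow> l \<le> r \<Longrightarrow> (c, l) \<in> S"
  shows "measure_pmf.prob (draws P far z) H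
    \<le> measure_pmf.prob (meb_outliers_alg P t z ctr far) S"
  unfolding meb_outliers_alg_def measure_map_pmf
proof (rule measure_pmf.finite_measure_mono_AE)
  show "AE h in measure_pmf (draws P far z). h \<in> H \<longrightarrow> h \<in> (\<lambda>h.
       let c = (\<lambda>i. ctr (take i h));
           l = (\<lambda>i. kth_largest_dist (t + 1) P (c i));
           i = arg_min_on l {1..z}
       in (c i, l i)) -` S"
    unfolding AE_measure_pmf_iff
  proof (intro ballI impI)
    fix h assume h: "h \<in> set_pmf (draws P far z)" "h \<in> H"
    define l where "l = (\<lambda>i. kth_largest_dist (t + 1) P (ctr (take i h)))"
    obtain j where j: "j \<in> {1..z}" "l j \<le> r" using assms(1)[OF h] by (auto simp: l_def)
    then have "l (arg_min_on l {1..z}) \<le> r"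
      using arg_min_least[of "{1..z}" j l] by auto
    then show "h \<in> (\<lambda>h.
       let c = (\<lambda>i. ctr (take i h));
           l = (\<lambda>i. kth_largest_dist (t + 1) P (c i));
           i = arg_min_on l {1..z}
       in (c i, l i)) -` S"
      using assms(2) by (simp add: Let_def l_def)
  qed
qed simp

subsection \<open>The approximation guarantee\<close>

text \<open>The deterministic core. If all radii were larger, every point drawn in a round would be
  far from the exact center, and \<open>z\<close> such insertions would push the radius of the drawn
  set beyond that of \<open>A\<close>, which contains it.\<close>

lemma exists_small_kth_largest_dist:
  fixes P :: "'a::euclidean_space set"
  assumes "finite P" "t < card P" "A \<subseteq> P" "0 < \<epsilon>" "0 \<le> s" "s < 1"
    and z: "real z = 2 / ((1 - s) * \<epsilon>)"
    and h: "length h = Suc z" "set h \<subseteq> A"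
    and ctr: "\<And>i. 1 \<le> i \<Longrightarrow> i \<le> z \<Longrightarrow> approx_center s \<epsilon> (set (take i h)) (ctr (take i h))"
    and far: "\<And>i. 1 \<le> i \<Longrightarrow> i \<le> z \<Longrightarrow> is_farthest_set P (ctr (take i h)) t (far (take i h))"
    and hi: "\<And>i. 1 \<le> i \<Longrightarrow> i \<le> z \<Longrightarrow> h ! i \<in> far (take i h)"
  shows "\<exists>j\<in>{1..z}. kth_largest_dist (t + 1) P (ctr (take j h)) \<le> (1 + \<epsilon>) * meb_rad A"
proof (rule ccontr)
  assume neg: "\<not> ?thesis"
  define r where "r = meb_rad A"
  \<comment> \<open>The distance \<open>(1 + \<epsilon>) * r\<close> from the approximate center,
    less the error \<open>s * \<epsilon> * r\<close> of that center.\<close>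
  define D where "D = (1 + (1 - s) * \<epsilon>) * r"
  have finA: "finite A" using assms(1,3) finite_subset by blast
  have "h \<noteq> []" using h(1) by auto
  then have "A \<noteq> {}" using h(2) by auto
  then have r: "0 \<le> r" using meb_rad_nonneg finA by (simp add: r_def)
  have D: "0 \<le> D" using r assms(4,6) by (simp add: D_def)
  have far': "D < dist (meb_center (set (take i h))) (h ! i)" if i: "1 \<le> i" "i \<le> z" for i
  proof -
    let ?T = "set (take i h)" and ?o = "ctr (take i h)"
    have T: "?T \<noteq> {}" "?T \<subseteq> A" using i h set_take_subset[of i h] by auto
    have R: "0 \<le> meb_rad ?T" "meb_rad ?T \<le> r"
      using T finA meb_rad_mono[OF T(2) finA T(1)] meb_rad_nonneg[of ?T] by (auto simp: r_def)
    \<comment> \<open>Both branches of \<open>approx_center\<close> give this weak bound; for radius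
      0 both sides vanish.\<close>
    have "dist ?o (meb_center ?T) \<le> s * (\<epsilon> / (1 + \<epsilon>)) * meb_rad ?T"
      using ctr[OF i] by (auto simp: approx_center_def dist_norm split: if_splits)
    also have "\<dots> \<le> s * \<epsilon> * r"
      using R assms(4,5) by (intro mult_mono mult_left_mono) (auto simp: field_simps)
    finally have 1: "dist ?o (meb_center ?T) \<le> s * \<epsilon> * r" .
    have "(1 + \<epsilon>) * r < dist (h ! i) ?o"
      using neg i is_farthest_set_dist_ge[OF assms(1,2) far[OF i] hi[OF i]]
      by (force simp: r_def)
    also have "\<dots> \<le> dist (h ! i) (meb_center ?T) + dist ?o (meb_center ?T)"
      by (rule dist_triangle2)
    finally show ?thesis using 1 by (simp add: D_def algebra_simps dist_commute)
  qed
  \<comment> \<open>\<open>1 \<le> z\<close> gives access to the strict half of the growth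
    bound.\<close>
  have zpos: "real z * ((1 - s) * \<epsilon>) = 2" "1 \<le> z"
  proof -
    show *: "real z * ((1 - s) * \<epsilon>) = 2" using z assms(4,6) by simp
    then show "1 \<le> z" by (cases z) auto
  qed
  have "real z * D < (real z + 2) * meb_rad (set (take (Suc z) h))"
    using meb_rad_far_insertions[OF D _ far', of z] h zpos(2) by simp
  also have "\<dots> \<le> (real z + 2) * r"
    using h finA \<open>h \<noteq> []\<close> meb_rad_mono[of "set h" A] by (intro mult_left_mono) (auto simp: r_def)
  \<comment> \<open>The value of \<open>z\<close> is made for this:
    \<open>z * (1 - s) * \<epsilon> = 2\<close> turns \<open>z * D\<close> into
    \<open>(z + 2) * r\<close>.\<close>
  also have "\<dots> = real z * D"
    using zpos(1) unfolding D_def by (metis distrib_left distrib_right mult.assoc mult.right_neutral)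
  finally show False by simp
qed

theorem theorem5:
  fixes P :: "(real ^ 'd) set" and n t z :: nat and \<gamma> \<epsilon> \<delta> s :: real
    and ctr :: "(real ^ 'd) list \<Rightarrow> real ^ 'd"
    and far :: "(real ^ 'd) list \<Rightarrow> (real ^ 'd) set"
  assumes "finite P" and "card P = n" and "n \<ge> 1"
    and "0 < \<gamma>" and "\<gamma> < 1"
    and "0 < \<epsilon>" and "\<epsilon> < 1"
    and "0 < \<delta>" and "\<delta> < 1"
    and "s = \<epsilon> / (2 + \<epsilon>)"
    and "real z = 2 / ((1 - s) * \<epsilon>)"
    and "real t = (\<delta> + \<gamma>) * real n"
    and "(1 - \<gamma>) * real n \<in> \<nat>"
    and "\<And>h. h \<noteq> [] \<Longrightarrow> set h \<subseteq> P \<Longrightarrow> length h \<le> z \<Longrightarrow> approx_center s \<epsilon> (set h) (ctr h)"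
    and "\<And>h. h \<noteq> [] \<Longrightarrow> set h \<subseteq> P \<Longrightarrow> length h \<le> z \<Longrightarrow> is_farthest_set P (ctr h) t (far h)"
  shows "measure_pmf.prob (meb_outliers_alg P t z ctr far)
           {(c, r). bicriteria_approx P \<gamma> \<epsilon> \<delta> c r}
         \<ge> (1 - \<gamma>) * (\<delta> / (\<gamma> + \<delta>)) ^ z"
proof -
  have P: "P \<noteq> {}" using assms(2,3) by auto
  obtain A where A: "is_P_opt P \<gamma> A"
    using is_P_opt_exists[of P \<gamma>] assms by auto
  then have cardA: "A \<subseteq> P" "real (card A) = (1 - \<gamma>) * real n"
    using assms(2) by (auto simp: is_P_opt_def)
  have finA: "finite A" using cardA(1) assms(1) by (rule finite_subset)
  have "0 < real (card A)" using cardA(2) assms(3,5) by simp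
  then have "A \<noteq> {}" by auto
  then have r: "0 \<le> (1 + \<epsilon>) * meb_rad A" using meb_rad_nonneg[OF finA] assms(6) by simp
  have s: "0 \<le> s" "s < 1" using assms(6,10) by auto
  show ?thesis
  proof (cases "t < n")
    \<comment> \<open>Every radius is 0 by the convention in \<open>kth_largest_dist\<close>, and
      the required coverage is at most 0, so every output is good.\<close>
    case False
    then have kth: "kth_largest_dist (t + 1) P c = 0" for c
      using assms(2) by (simp add: kth_largest_dist_def)
    have "real n \<le> (\<delta> + \<gamma>) * real n" using False assms(12) by (metis not_le of_nat_le_iff)
    then have "(1 - \<delta> - \<gamma>) * real n \<le> 0" by (simp add: algebra_simps)
    then have good: "bicriteria_approx P \<gamma> \<epsilon> \<delta> c 0" for c
      using A r assms(2) unfolding bicriteria_approx_def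
      by (metis of_nat_0_le_iff order_refl order_trans)
    have "set_pmf (meb_outliers_alg P t z ctr far) \<subseteq> {(c, r). bicriteria_approx P \<gamma> \<epsilon> \<delta> c r}"
      by (auto simp: meb_outliers_alg_def Let_def kth[simplified] good)
    then have "measure_pmf.prob (meb_outliers_alg P t z ctr far)
        {(c, r). bicriteria_approx P \<gamma> \<epsilon> \<delta> c r} = 1"
      by (intro measure_pmf.prob_eq_1[THEN iffD2]) (auto simp: AE_measure_pmf_iff)
    moreover have "(1 - \<gamma>) * (\<delta> / (\<gamma> + \<delta>)) ^ z \<le> 1"
      using assms(4-9) by (intro mult_le_one power_le_one) auto
    ultimately show ?thesis by simp
  next
    case True
    have tpos: "0 < t" using assms(3,4,8,12) by (metis add_pos_pos mult_pos_pos of_nat_0_less_iff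
          less_le_trans zero_less_one)
    have far: "far h \<subseteq> P \<and> far h \<noteq> {} \<and>
        \<delta> / (\<gamma> + \<delta>) * real (card (far h)) \<le> real (card (far h \<inter> A))"
      if h: "h \<noteq> []" "set h \<subseteq> P" "length h \<le> z" for h
    proof -
      have f: "far h \<subseteq> P" "card (far h) = t"
        using assms(15)[OF h] True assms(2) by (auto simp: is_farthest_set_def)
      have "card (far h) = card (far h \<inter> A) + card (far h - A)"
        using finite_subset[OF f(1) assms(1)] by (metis card_Int_Diff)
      moreover have "card (far h - A) \<le> card (P - A)"
        using f(1) assms(1) by (intro card_mono) auto
      moreover have "card (P - A) + card A = n"
        using cardA(1) assms(1,2) by (metis card_Diff_subset card_mono finA le_add_diff_inverse2)
      ultimately have "real t \<le> real (card (far h \<inter> A)) + (real n - real (card A))"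
        using f(2) by linarith
      then have "\<delta> * real n \<le> real (card (far h \<inter> A))"
        using cardA(2) assms(12) by (simp add: algebra_simps)
      \<comment> \<open>Since \<open>t = (\<delta> + \<gamma>) * n\<close>, the count
        \<open>\<delta> * n\<close> is exactly the claimed share of the far set.\<close>
      moreover have "\<delta> / (\<gamma> + \<delta>) * real t = \<delta> * real n"
        using assms(4,8,12) by (simp add: field_simps)
      ultimately show ?thesis using f tpos by auto
    qed
    have "(1 - \<gamma>) * (\<delta> / (\<gamma> + \<delta>)) ^ z \<le> measure_pmf.prob (draws P far z) {h. set h \<subseteq> A}"
      using assms(1,2,4,8) P cardA far by (intro prob_draws_subset[where z = z]) auto
    also have "\<dots> \<le> measure_pmf.prob (meb_outliers_alg P t z ctr far)
           {(c, r). bicriteria_approx P \<gamma> \<epsilon> \<delta> c r}"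
    proof (rule prob_meb_outliers_alg_ge[where r = "(1 + \<epsilon>) * meb_rad A"])
      fix h assume "h \<in> set_pmf (draws P far z)" and h: "h \<in> {h. set h \<subseteq> A}"
      then have *: "length h = Suc z" "set h \<subseteq> P"
          "\<And>j. 1 \<le> j \<Longrightarrow> j \<le> z \<Longrightarrow> h ! j \<in> far (take j h)"
        using set_pmf_draws[of P z far z h] assms(1) P far by auto
      \<comment> \<open>The prefix of length \<open>i \<le> z\<close> is the state of round
        \<open>i\<close>, to which the assumptions on \<open>ctr\<close> and \<open>far\<close>
        apply.\<close>
      have take: "take i h \<noteq> []" "set (take i h) \<subseteq> P" "length (take i h) \<le> z"
        if "1 \<le> i" "i \<le> z" for i
        using that * set_take_subset[of i h] by auto
      show "\<exists>j\<in>{1..z}. kth_largest_dist (t + 1) P (ctr (take j h)) \<le> (1 + \<epsilon>) * meb_rad A"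
        using assms(1,2,6,11) True cardA(1) s * h assms(14,15)[OF take]
        by (intro exists_small_kth_largest_dist[where s = s and far = far]) auto
    next
      fix c and l :: real
      assume l: "l = kth_largest_dist (t + 1) P c" "l \<le> (1 + \<epsilon>) * meb_rad A"
      \<comment> \<open>The ball misses at most \<open>t\<close> points, and \<open>n - t\<close> is
        the required coverage.\<close>
      have "(1 - \<delta> - \<gamma>) * real n = real (n - t)"
        using assms(12) True by (simp add: algebra_simps of_nat_diff)
      then show "(c, l) \<in> {(c, r). bicriteria_approx P \<gamma> \<epsilon> \<delta> c r}"
        using kth_largest_dist_nonneg[of P t c] card_le_kth_largest_dist[of P t c] l A True assms(1,2)
        by (auto simp: bicriteria_approx_def)
    qed
    finally show ?thesis .
  qed
qed

end
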